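(* Let $G$ be the incomparability graph of a poset. Suppose that $G$ is connected and has infinite diameter. Then: (1) For every vertex $x$ of $G$ there is a (one way infinite) induced path of $G$ starting at $x$ whose vertex set has infinite diameter in $G$. (2) If the set of vertices of degree at least $3$ in $G$ has infinite diameter in $G$, then $G$ contains an induced subgraph $H$ which is a comb or a kite, such that the vertex set of $H$ has infinite diameter in $G$ and $H$ has infinitely many vertices of degree at least $3$.
   Context: Graphs are undirected, simple, loopless, possibly infinite. For a poset $P=(V,\le)$, the incomparability graph $\mathrm{Inc}(P)$ has vertex set $V$ and edges the pairs of incomparable elements. $d_G(x,y)$ is the length of a shortest path of $G$ from $x$ to $y$ ($\infty$ if none). The diameter in $G$ of a set $X\subseteq V(G)$ is $\sup\{d_G(x,y):x,y\in X\}$; the diameter of $G$ is that of $V(G)$. A one way infinite induced path starting at $x$ is a sequence $x=x_0,x_1,x_2,\dots$ of distinct vertices such that $\{x_i,x_j\}$ is an edge of $G$ iff $|i-j|=1$. A caterpillar is a connected graph such that deleting all vertices of degree one leaves a path (finite or infinite, possibly reduced to one vertex or empty). A comb is a caterpillar in which every vertex is adjacent to at most one vertex of degree one. A kite is a graph obtained from an infinite path $\mathrm P_\infty=(x_i)_{i\in\mathbb N}$ (with edges $\{x_i,x_{i+1}\}$ only) by adding a set $Y$ (finite or infinite) of new pairwise non-adjacent vertices, according to one of the following three types. Type (1): every vertex of $Y$ is adjacent to exactly two vertices of $\mathrm P_\infty$, and these are consecutive in $\mathrm P_\infty$; moreover two distinct vertices of $Y$ have at most one common neighbour in $\mathrm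 P_\infty$. Type (2): every vertex of $Y$ is adjacent to exactly three vertices of $\mathrm P_\infty$, and these are consecutive in $\mathrm P_\infty$; moreover for all distinct $y,y'\in Y$, if $y$ is adjacent to $x_i,x_{i+1},x_{i+2}$ and $y'$ to $x_{i'},x_{i'+1},x_{i'+2}$, then $i+2\le i'$ or $i'+2\le i$. Type (3): every vertex of $Y$ is adjacent to exactly two vertices of $\mathrm P_\infty$, and these are at distance two in $\mathrm P_\infty$; moreover for all distinct $y,y'\in Y$, if $y$ is adjacent to $x_i,x_{i+2}$ and $y'$ to $x_{i'},x_{i'+2}$, then $i+2\le i'$ or $i'+2\le i$. *)

theory Defs
  imports Main "HOL-Library.Extended_Nat"
begin

record 'a graph =
  vertices :: "'a set"
  edges :: "'a set set"

definition simple_graph :: "'a graph \<Rightarrow> bool" where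
  "simple_graph G \<longleftrightarrow> (\<forall>e\<in>edges G. e \<subseteq> vertices G \<and> card e = 2)"

definition adjacent :: "'a graph \<Rightarrow> 'a \<Rightarrow> 'a \<Rightarrow> bool" where
  "adjacent G u v \<longleftrightarrow> {u, v} \<in> edges G"

definition inc_graph :: "'a set \<Rightarrow> 'a rel \<Rightarrow> 'a graph" where
  "inc_graph V r = \<lparr>vertices = V,
     edges = {{x, y} | x y. x \<in> V \<and> y \<in> V \<and> (x, y) \<notin> r \<and> (y, x) \<notin> r}\<rparr>"

definition induced_on :: "'a graph \<Rightarrow> 'a set \<Rightarrow> 'a graph" where
  "induced_on G W = \<lparr>vertices = W, edges = {e \<in> edges G. e \<subseteq> W}\<rparr>"

definition induced_subgraph_of :: "'a graph \<Rightarrow> 'a graph \<Rightarrow> bool" where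
  "induced_subgraph_of H G \<longleftrightarrow> vertices H \<subseteq> vertices G \<and> H = induced_on G (vertices H)"

definition nbhd :: "'a graph \<Rightarrow> 'a \<Rightarrow> 'a set" where
  "nbhd G u = {v \<in> vertices G. adjacent G u v}"

(* card is 0 on infinite sets, hence the case distinction *)
definition vertex_degree :: "'a graph \<Rightarrow> 'a \<Rightarrow> enat" where
  "vertex_degree G u = (if finite (nbhd G u) then enat (card (nbhd G u)) else \<infinity>)"

definition path_between :: "'a graph \<Rightarrow> 'a \<Rightarrow> 'a \<Rightarrow> 'a list \<Rightarrow> bool" where
  "path_between G x y p \<longleftrightarrow> p \<noteq> [] \<and> hd p = x \<and> last p = y \<and> distinct p \<and>
     set p \<subseteq> vertices G \<and> successively (adjacent G) p"

definition connected_graph :: "'a graph \<Rightarrow> bool" where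
  "connected_graph G \<longleftrightarrow> (\<forall>x\<in>vertices G. \<forall>y\<in>vertices G. \<exists>p. path_between G x y p)"

(* the infimum of the empty set in enat is \<infinity> *)
definition graph_dist :: "'a graph \<Rightarrow> 'a \<Rightarrow> 'a \<Rightarrow> enat" where
  "graph_dist G x y = (INF p\<in>{p. path_between G x y p}. enat (length p - 1))"

definition graph_diameter :: "'a graph \<Rightarrow> 'a set \<Rightarrow> enat" where
  "graph_diameter G X = (SUP (x, y)\<in>X \<times> X. graph_dist G x y)"

definition induced_ray :: "'a graph \<Rightarrow> (nat \<Rightarrow> 'a) \<Rightarrow> bool" where
  "induced_ray G x \<longleftrightarrow> inj x \<and> range x \<subseteq> vertices G \<and>
     (\<forall>i j. adjacent G (x i) (x j) \<longleftrightarrow> \<bar>int i - int j\<bar> = 1)"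

(* I is an arbitrary interval of the integers, so finite, one-way infinite and
   two-way infinite paths are covered, as well as the empty graph *)
definition path_graph :: "'a graph \<Rightarrow> bool" where
  "path_graph G \<longleftrightarrow> (\<exists>(I :: int set) f.
     (\<forall>i\<in>I. \<forall>j\<in>I. {i..j} \<subseteq> I) \<and> bij_betw f I (vertices G) \<and>
     (\<forall>i\<in>I. \<forall>j\<in>I. adjacent G (f i) (f j) \<longleftrightarrow> \<bar>i - j\<bar> = 1))"

definition caterpillar :: "'a graph \<Rightarrow> bool" where
  "caterpillar G \<longleftrightarrow> simple_graph G \<and> connected_graph G \<and>
     path_graph (induced_on G {v \<in> vertices G. vertex_degree G v \<noteq> 1})"

definition comb :: "'a graph \<Rightarrow> bool" where
  "comb G \<longleftrightarrow> caterpillar G \<and>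
     (\<forall>v\<in>vertices G. \<forall>u\<in>nbhd G v. \<forall>w\<in>nbhd G v.
        vertex_degree G u = 1 \<and> vertex_degree G w = 1 \<longrightarrow> u = w)"

(* G is the ray x together with a disjoint independent set Y *)
definition ray_extension :: "'a graph \<Rightarrow> (nat \<Rightarrow> 'a) \<Rightarrow> 'a set \<Rightarrow> bool" where
  "ray_extension G x Y \<longleftrightarrow> simple_graph G \<and> induced_ray G x \<and>
     vertices G = range x \<union> Y \<and> range x \<inter> Y = {} \<and>
     (\<forall>y\<in>Y. \<forall>y'\<in>Y. \<not> adjacent G y y')"

definition kite1 :: "'a graph \<Rightarrow> bool" where
  "kite1 G \<longleftrightarrow> (\<exists>x Y. ray_extension G x Y \<and>
     (\<forall>y\<in>Y. \<exists>i. nbhd G y \<inter> range x = {x i, x (i + 1)}) \<and>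
     (\<forall>y\<in>Y. \<forall>y'\<in>Y. y \<noteq> y' \<longrightarrow>
        (\<forall>u v. {u, v} \<subseteq> nbhd G y \<inter> nbhd G y' \<inter> range x \<longrightarrow> u = v)))"

definition kite2 :: "'a graph \<Rightarrow> bool" where
  "kite2 G \<longleftrightarrow> (\<exists>x Y. ray_extension G x Y \<and>
     (\<forall>y\<in>Y. \<exists>i. nbhd G y \<inter> range x = {x i, x (i + 1), x (i + 2)}) \<and>
     (\<forall>y\<in>Y. \<forall>y'\<in>Y. y \<noteq> y' \<longrightarrow>
        (\<forall>i i'. {x i, x (i + 1), x (i + 2)} \<subseteq> nbhd G y \<and>
                {x i', x (i' + 1), x (i' + 2)} \<subseteq> nbhd G y' \<longrightarrow>
                i + 2 \<le> i' \<or> i' + 2 \<le> i)))"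

definition kite3 :: "'a graph \<Rightarrow> bool" where
  "kite3 G \<longleftrightarrow> (\<exists>x Y. ray_extension G x Y \<and>
     (\<forall>y\<in>Y. \<exists>i. nbhd G y \<inter> range x = {x i, x (i + 2)}) \<and>
     (\<forall>y\<in>Y. \<forall>y'\<in>Y. y \<noteq> y' \<longrightarrow>
        (\<forall>i i'. {x i, x (i + 2)} \<subseteq> nbhd G y \<and> {x i', x (i' + 2)} \<subseteq> nbhd G y' \<longrightarrow>
                i + 2 \<le> i' \<or> i' + 2 \<le> i)))"

definition kite :: "'a graph \<Rightarrow> bool" where
  "kite G \<longleftrightarrow> kite1 G \<or> kite2 G \<or> kite3 G"

end

theory Submission
  imports Defs
begin

text \<open>If \<open>x < y < z\<close> then every path from \<open>x\<close> to \<open>z\<close> meets the closed neighbourhood of \<open>y\<close>. Hence,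
  among the vertices above \<open>x\<close>, those whose distances from \<open>x\<close> differ by at least two are ordered by
  that distance, and a geodesic from \<open>x\<close> to a far vertex passes next to all the nearer ones. Gluing
  the final parts of such geodesics yields a connected set \<open>W\<close> with finitely many vertices at each
  distance from \<open>x\<close>; by Koenig's lemma it contains a ray that is geodesic in the graph induced on
  \<open>W\<close>, and this ray is far from \<open>x\<close>.

  If moreover the far vertices have degree at least three and \<open>W\<close> contains three neighbours of each
  of them, then vertices of \<open>W\<close> off the ray are attached to it arbitrarily far out. As the ray is
  geodesic in \<open>W\<close>, the neighbours on it of such a vertex lie in a window of three consecutive
  vertices. Infinitely many of these vertices have the same pattern of neighbours and are far apart;
  according to the pattern they form a comb or a kite of one of the three types with the ray.\<close>

section \<open>Distances\<close>

text \<open>Distances are set up for an arbitrary relation because two of them are compared later: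
  the distance in the whole graph and the one in the graph induced on a subset. \<open>LEAST\<close>
  is unspecified when \<open>y\<close> is unreachable, hence the reachability premises of the lemmas
  below.\<close>

definition rel_dist :: "'b rel \<Rightarrow> 'b \<Rightarrow> 'b \<Rightarrow> nat" where
  "rel_dist E x y = (LEAST n. (x, y) \<in> E ^^ n)"

lemma rel_dist_le: "(x, y) \<in> E ^^ n \<Longrightarrow> rel_dist E x y \<le> n"
  unfolding rel_dist_def by (rule Least_le)

lemma relpow_rel_dist: "(x, y) \<in> E\<^sup>* \<Longrightarrow> (x, y) \<in> E ^^ rel_dist E x y"
  unfolding rel_dist_def by (metis LeastI rtrancl_imp_relpow)

lemma rel_dist_self [simp]: "rel_dist E x x = 0"
  using rel_dist_le[of x x 0 E] by simp

lemma rel_dist_add_le: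
  assumes "(x, y) \<in> E\<^sup>*" "(y, z) \<in> E ^^ n"
  shows "rel_dist E x z \<le> rel_dist E x y + n"
  by (metis assms relpow_add relpow_rel_dist relcompI rel_dist_le)

lemma rel_dist_step_le:
  assumes "(x, y) \<in> E\<^sup>*" "(y, z) \<in> E"
  shows "rel_dist E x z \<le> Suc (rel_dist E x y)"
  using rel_dist_add_le[of x y E z 1] assms by simp

lemma rel_dist_triangle:
  assumes "(x, y) \<in> E\<^sup>*" "(y, z) \<in> E\<^sup>*"
  shows "rel_dist E x z \<le> rel_dist E x y + rel_dist E y z"
  using rel_dist_add_le relpow_rel_dist assms by metis

lemma rel_dist_commute:
  assumes "sym E"
  shows "rel_dist E x y = rel_dist E y x"
proof -
  have "(x, y) \<in> E ^^ n \<Longrightarrow> (y, x) \<in> E ^^ n" for n x y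
  proof (induction n arbitrary: y)
    case (Suc n)
    then obtain z where "(x, z) \<in> E ^^ n" "(z, y) \<in> E" by auto
    then show ?case using Suc.IH assms by (meson relpow_Suc_I2 symD)
  qed simp
  then have "(x, y) \<in> E ^^ n \<longleftrightarrow> (y, x) \<in> E ^^ n" for n by blast
  then show ?thesis by (simp add: rel_dist_def)
qed

section \<open>Geodesics and Koenig's lemma\<close>

lemma unbounded_imp_infinite:
  fixes d :: "'b \<Rightarrow> nat"
  assumes "\<And>n. \<exists>v\<in>A. n \<le> d v"
  shows "infinite A"
proof
  assume "finite A"
  obtain v where v: "v \<in> A" "Suc (Max (d ` A)) \<le> d v" using assms by blast
  then have "d v \<le> Max (d ` A)" using \<open>finite A\<close> by simp
  then show False using v(2) by linarith
qed

lemma geodesic_exists: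
  assumes "(x, y) \<in> E\<^sup>*"
  shows "\<exists>g. g 0 = x \<and> g (rel_dist E x y) = y \<and>
    (\<forall>i<rel_dist E x y. (g i, g (Suc i)) \<in> E) \<and> (\<forall>i\<le>rel_dist E x y. rel_dist E x (g i) = i)"
proof -
  let ?m = "rel_dist E x y"
  obtain g where g: "g 0 = x" "g ?m = y" "\<And>i. i < ?m \<Longrightarrow> (g i, g (Suc i)) \<in> E"
    using relpow_rel_dist[OF assms] unfolding relpow_fun_conv by blast
  have to: "(x, g i) \<in> E ^^ i" if "i \<le> ?m" for i
    unfolding relpow_fun_conv using g that by (intro exI[of _ g]) auto
  have "(g i, y) \<in> E ^^ (?m - i)" if "i \<le> ?m" for i
    unfolding relpow_fun_conv using g that by (intro exI[of _ "\<lambda>j. g (i + j)"]) auto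
  \<comment> \<open>Going to \<open>g i\<close> along a shortest walk and then along the rest of
    \<open>g\<close> cannot beat the minimum \<open>?m\<close>, so \<open>g i\<close> is at distance
    at least \<open>i\<close>.\<close>
  then have "?m \<le> rel_dist E x (g i) + (?m - i)" if "i \<le> ?m" for i
    using rel_dist_add_le to that relpow_imp_rtrancl by metis
  then have "rel_dist E x (g i) = i" if "i \<le> ?m" for i
    using rel_dist_le[OF to[OF that]] that by (metis diff_diff_cancel le_antisym le_diff_conv)
  then show ?thesis using g by blast
qed

text \<open>Koenig's lemma by distance layers: keep a vertex through which geodesics from
  \<open>x\<close> reach infinitely many vertices; by local finiteness, one of its finitely many
  successors in the next layer inherits this.\<close>

lemma geodesic_ray_exists:
  assumes fin: "\<And>v. finite (E `` {v})" and inf: "infinite (E\<^sup>* `` {x})"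
  shows "\<exists>f. f 0 = x \<and> (\<forall>n. (f n, f (Suc n)) \<in> E) \<and> (\<forall>n. rel_dist E x (f n) = n)"
proof -
  \<comment> \<open>For \<open>v\<close> reachable from \<open>x\<close>, these are the vertices
    that some geodesic from \<open>x\<close> reaches by way of \<open>v\<close>.\<close>
  define B where "B v = {w. (v, w) \<in> E\<^sup>* \<and> rel_dist E x w = rel_dist E x v + rel_dist E v w}" for v
  let ?P = "\<lambda>n v. (x, v) \<in> E\<^sup>* \<and> rel_dist E x v = n \<and> infinite (B v)"
  have "B x = E\<^sup>* `` {x}" by (auto simp: B_def)
  then have init: "\<exists>v. ?P 0 v" using inf by (intro exI[of _ x]) simp
  have step: "\<exists>u. ?P (Suc n) u \<and> (v, u) \<in> E" if P: "?P n v" for v n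
  proof -
    let ?U = "{u \<in> E `` {v}. rel_dist E x u = Suc n}"
    \<comment> \<open>A vertex \<open>w\<close> of \<open>B v\<close> other than \<open>v\<close>
      lies beyond the first step \<open>u\<close> of a shortest walk from \<open>v\<close> to
      \<open>w\<close>; equality in the distance estimates puts \<open>u\<close> in the next layer
      and \<open>w\<close> in \<open>B u\<close>.\<close>
    have "B v \<subseteq> insert v (\<Union>u\<in>?U. B u)"
    proof
      fix w assume w: "w \<in> B v"
      show "w \<in> insert v (\<Union>u\<in>?U. B u)"
      proof (cases "rel_dist E v w")
        case 0
        then have "w = v" using w relpow_rel_dist[of v w E] by (auto simp: B_def)
        then show ?thesis by simp
      next
        case (Suc k)
        then obtain u where u: "(v, u) \<in> E" "(u, w) \<in> E ^^ k"
          using w relpow_rel_dist[of v w E] relpow_Suc_D2[of v w k E] by (auto simp: B_def)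
        have xu: "(x, u) \<in> E\<^sup>*" "(u, w) \<in> E\<^sup>*"
          using P u relpow_imp_rtrancl by (auto intro: rtrancl_into_rtrancl)
        have "rel_dist E x w = n + Suc k" using w Suc P by (simp add: B_def)
        moreover have "rel_dist E x u \<le> Suc n" using rel_dist_step_le P u by metis
        moreover have "rel_dist E u w \<le> k" using u by (simp add: rel_dist_le)
        moreover have "rel_dist E x w \<le> rel_dist E x u + rel_dist E u w"
          using xu by (rule rel_dist_triangle)
        ultimately have "rel_dist E x u = Suc n" "u \<in> ?U" "w \<in> B u"
          using u xu by (auto simp: B_def)
        then show ?thesis by blast
      qed
    qed
    moreover have "finite ?U" using fin by (rule rev_finite_subset) auto
    ultimately obtain u where "u \<in> ?U" "infinite (B u)"
      using P by (meson finite_UN_I finite_insert finite_subset)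
    then show ?thesis using P by (intro exI[of _ u]) (auto intro: rtrancl_into_rtrancl)
  qed
  obtain f where f: "\<And>n. ?P n (f n)" "\<And>n. (f n, f (Suc n)) \<in> E"
    using dependent_nat_choice[of ?P "\<lambda>n v u. (v, u) \<in> E", OF init step] by blast
  have "f 0 = x" using f(1)[of 0] relpow_rel_dist[of x "f 0" E] by simp
  then show ?thesis using f by blast
qed

section \<open>Graph paths as powers of the adjacency relation\<close>

definition adj_rel :: "'a graph \<Rightarrow> 'a rel" where
  "adj_rel G = {(u, v). u \<in> vertices G \<and> v \<in> vertices G \<and> adjacent G u v}"

lemma adj_rel_iff: "(u, v) \<in> adj_rel G \<longleftrightarrow> u \<in> vertices G \<and> v \<in> vertices G \<and> adjacent G u v"
  by (simp add: adj_rel_def)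

lemma sym_adj_rel: "sym (adj_rel G)"
  by (auto simp: sym_def adj_rel_def adjacent_def insert_commute)

lemma path_between_imp_relpow:
  assumes "path_between G x y p"
  shows "(x, y) \<in> adj_rel G ^^ (length p - 1)"
  unfolding relpow_fun_conv using assms
  by (intro exI[of _ "(!) p"])
    (auto simp: path_between_def hd_conv_nth last_conv_nth successively_conv_nth adj_rel_def
        subset_iff)

lemma relpow_imp_path_between:
  assumes "(x, y) \<in> adj_rel G ^^ n" "x \<in> vertices G"
  shows "\<exists>p. path_between G x y p \<and> length p \<le> Suc n"
  using assms(1)
proof (induction n arbitrary: y)
  case 0
  then show ?case using assms(2) by (intro exI[of _ "[x]"]) (auto simp: path_between_def)
next
  case (Suc n)
  then obtain z where z: "(x, z) \<in> adj_rel G ^^ n" "(z, y) \<in> adj_rel G" by auto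
  obtain p where p: "path_between G x z p" "length p \<le> Suc n" using Suc.IH z by blast
  show ?case
  proof (cases "y \<in> set p")
    case True
    \<comment> \<open>The walk may return to a vertex of the path built so far; the path is then cut
      at that vertex, which is why its length is only bounded.\<close>
    then obtain q s where qs: "p = q @ y # s" by (meson split_list)
    then have "path_between G x y (q @ [y])"
      using p(1) by (auto simp: path_between_def successively_append_iff hd_append)
    then show ?thesis using qs p(2) by (intro exI[of _ "q @ [y]"]) auto
  next
    case False
    then have "path_between G x y (p @ [y])"
      using p(1) z(2) by (auto simp: path_between_def successively_append_iff adj_rel_def)
    then show ?thesis using p(2) by (intro exI[of _ "p @ [y]"]) auto
  qed
qed

lemma connected_graph_iff:
  "connected_graph G \<longleftrightarrow> (\<forall>x\<in>vertices G. \<forall>y\<in>vertices G. (x, y) \<in> (adj_rel G)\<^sup>*)"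
  unfolding connected_graph_def
  by (meson path_between_imp_relpow relpow_imp_path_between relpow_imp_rtrancl rtrancl_imp_relpow)

lemma graph_dist_eq_rel_dist:
  assumes "(x, y) \<in> (adj_rel G)\<^sup>*" "x \<in> vertices G"
  shows "graph_dist G x y = enat (rel_dist (adj_rel G) x y)"
proof (rule antisym)
  obtain p where p: "path_between G x y p" "length p \<le> Suc (rel_dist (adj_rel G) x y)"
    using relpow_imp_path_between relpow_rel_dist assms by metis
  then show "graph_dist G x y \<le> enat (rel_dist (adj_rel G) x y)"
    unfolding graph_dist_def by (intro INF_lower2[of p]) auto
  show "enat (rel_dist (adj_rel G) x y) \<le> graph_dist G x y"
    unfolding graph_dist_def
    by (intro INF_greatest) (simp add: rel_dist_le[OF path_between_imp_relpow, simplified])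
qed

text \<open>The base point \<open>x\<close> may lie outside \<open>X\<close>: were all of
  \<open>X\<close> closer than \<open>n\<close> to \<open>x\<close>, detours through
  \<open>x\<close> would bound its diameter by \<open>2 * n\<close>.\<close>

lemma infinite_diameter_imp_unbounded:
  assumes "connected_graph G" "graph_diameter G X = \<infinity>" "X \<subseteq> vertices G" "x \<in> vertices G"
  shows "\<exists>v\<in>X. n \<le> rel_dist (adj_rel G) x v"
proof (rule ccontr)
  let ?d = "rel_dist (adj_rel G)"
  assume "\<not> ?thesis"
  then have less: "?d x v < n" if "v \<in> X" for v using that by force
  have reach: "(u, v) \<in> (adj_rel G)\<^sup>*" if "u \<in> vertices G" "v \<in> vertices G" for u v
    using assms(1) that by (simp add: connected_graph_iff)
  have "graph_dist G u v \<le> enat (2 * n)" if "u \<in> X" "v \<in> X" for u v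
  proof -
    have "?d u v \<le> ?d u x + ?d x v"
      using assms that by (intro rel_dist_triangle reach) auto
    also have "?d u x = ?d x u" by (rule rel_dist_commute[OF sym_adj_rel])
    finally have "?d u v \<le> 2 * n" using less[OF that(1)] less[OF that(2)] by linarith
    moreover have "u \<in> vertices G" "v \<in> vertices G" using that assms(3) by auto
    ultimately show ?thesis using graph_dist_eq_rel_dist[of u v G] reach by simp
  qed
  then have "graph_diameter G X \<le> enat (2 * n)"
    unfolding graph_diameter_def by (intro SUP_least) auto
  then show False using assms(2) by simp
qed

lemma infinite_diameterI:
  assumes "connected_graph G" "X \<subseteq> vertices G" "x \<in> X"
    and far: "\<And>n. \<exists>v\<in>X. n \<le> rel_dist (adj_rel G) x v"
  shows "graph_diameter G X = \<infinity>"
proof -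
  have "enat n \<le> graph_diameter G X" for n
  proof -
    obtain v where v: "v \<in> X" "n \<le> rel_dist (adj_rel G) x v" using far by blast
    moreover have "graph_dist G x v = enat (rel_dist (adj_rel G) x v)"
      using assms v by (intro graph_dist_eq_rel_dist) (auto simp: connected_graph_iff)
    ultimately show ?thesis
      unfolding graph_diameter_def using assms(3) by (intro SUP_upper2[of "(x, v)"]) auto
  qed
  then show ?thesis by (metis Suc_ile_eq enat.exhaust less_irrefl)
qed

section \<open>Incomparability graphs\<close>

text \<open>The strict order is kept apart from \<open>E\<close>, so that the reversed order
  together with the same \<open>E\<close> is again an instance.\<close>

locale incomparability =
  fixes V :: "'a set" and lt :: "'a \<Rightarrow> 'a \<Rightarrow> bool" and E :: "'a rel"
  assumes lt_trans: "lt a b \<Longrightarrow> lt b c \<Longrightarrow> lt a c"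
    and lt_irrefl: "\<not> lt a a"
    and E_iff: "(a, b) \<in> E \<longleftrightarrow> a \<in> V \<and> b \<in> V \<and> a \<noteq> b \<and> \<not> lt a b \<and> \<not> lt b a"
    and reach: "a \<in> V \<Longrightarrow> b \<in> V \<Longrightarrow> (a, b) \<in> E\<^sup>*"
begin

abbreviation d :: "'a \<Rightarrow> 'a \<Rightarrow> nat" where
  "d \<equiv> rel_dist E"

section \<open>How distance constrains the order\<close>

lemma E_sym: "(a, b) \<in> E \<Longrightarrow> (b, a) \<in> E"
  by (auto simp: E_iff)

lemma E_vertices: "(a, b) \<in> E \<Longrightarrow> a \<in> V \<and> b \<in> V"
  by (simp add: E_iff)

lemma lt_asym: "lt a b \<Longrightarrow> \<not> lt b a"
  using lt_trans lt_irrefl by blast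

lemma d_step: "x \<in> V \<Longrightarrow> (a, b) \<in> E \<Longrightarrow> d x b \<le> Suc (d x a)"
  by (meson E_vertices reach rel_dist_step_le)

lemma far_comparable:
  assumes "x \<in> V" "v \<in> V" "2 \<le> d x v"
  shows "lt x v \<or> lt v x"
proof (rule ccontr)
  assume "\<not> ?thesis"
  then have "v = x \<or> (x, v) \<in> E" using assms E_iff by auto
  then have "d x v \<le> 1" using d_step[of x x v] assms(1) by auto
  then show False using assms(3) by simp
qed

text \<open>By its distance \<open>u\<close> is comparable to \<open>x\<close>; if it were below,
  then \<open>u\<close>, \<open>x\<close>, \<open>v\<close> would form a chain, against the
  incomparability of \<open>u\<close> and \<open>v\<close>.\<close>

lemma adjacent_above:
  assumes "x \<in> V" "(u, v) \<in> E" "lt x v" "2 \<le> d x u"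
  shows "lt x u"
  using assms far_comparable[of x u] E_vertices[of u v] E_iff[of u v] lt_trans[of u x v] by blast

lemma walk_meets_nbhd:
  assumes g: "\<And>i. i < m \<Longrightarrow> (g i, g (Suc i)) \<in> E"
    and y: "y \<in> V" "lt (g 0) y" "lt y (g m)"
  shows "\<exists>i\<le>m. g i = y \<or> (g i, y) \<in> E"
proof (rule ccontr)
  assume no: "\<not> ?thesis"
  \<comment> \<open>While avoiding the closed neighbourhood of \<open>y\<close>, the walk cannot
    jump over \<open>y\<close>: with \<open>g i\<close> below \<open>y\<close> and
    \<open>g (Suc i)\<close> above it, transitivity would make two adjacent vertices
    comparable.\<close>
  have "i \<le> m \<Longrightarrow> lt (g i) y" for i
  proof (induction i)
    case (Suc i)
    then have "(g i, g (Suc i)) \<in> E" "lt (g i) y" using g by auto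
    moreover have "g (Suc i) \<noteq> y" "(g (Suc i), y) \<notin> E" using no Suc.prems by auto
    ultimately show ?case using y(1) lt_trans[of "g i" y "g (Suc i)"] by (auto simp: E_iff)
  qed (use y in simp)
  then show False using y(3) lt_asym by blast
qed

text \<open>An index on the geodesic is a distance from \<open>x\<close>, so the passage next to
  \<open>y\<close> can be located: it happens at index \<open>d x y - 1\<close> or later.\<close>

lemma geodesic_meets_nbhd:
  assumes "x \<in> V" "w \<in> V" "y \<in> V" "lt x y" "lt y w"
    and g: "g 0 = x" "g m = w" "\<And>i. i < m \<Longrightarrow> (g i, g (Suc i)) \<in> E"
      "\<And>i. i \<le> m \<Longrightarrow> d x (g i) = i"
  shows "\<exists>i\<le>m. (g i = y \<or> (g i, y) \<in> E) \<and> d x y \<le> Suc i"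
proof -
  obtain i where i: "i \<le> m" "g i = y \<or> (g i, y) \<in> E"
    using walk_meets_nbhd[of m g y] assms by auto
  then have "d x y \<le> Suc i" using d_step[of x "g i" y] g(4)[of i] assms(1) by auto
  then show ?thesis using i by blast
qed

text \<open>The only alternative is \<open>w\<close> below \<open>v\<close>. A geodesic from
  \<open>x\<close> to \<open>v\<close> would then pass next to \<open>w\<close>, so \<open>w\<close>
  would be at most one step further from \<open>x\<close> than \<open>v\<close>.\<close>

lemma layers_ordered:
  assumes "x \<in> V" "v \<in> V" "w \<in> V" "lt x v" "lt x w" "d x v + 2 \<le> d x w"
  shows "lt v w"
proof (rule ccontr)
  assume "\<not> lt v w"
  moreover have "v \<noteq> w" using assms by auto
  moreover have "(v, w) \<notin> E" using d_step[of x v w] assms by auto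
  ultimately have wv: "lt w v" using assms E_iff by auto
  obtain g where g: "g 0 = x" "g (d x v) = v"
    "\<And>i. i < d x v \<Longrightarrow> (g i, g (Suc i)) \<in> E" "\<And>i. i \<le> d x v \<Longrightarrow> d x (g i) = i"
    using geodesic_exists[OF reach[OF assms(1,2)]] by blast
  show False
    using geodesic_meets_nbhd[OF assms(1,2,3,5) wv g] assms(6) by auto
qed

section \<open>Thin connected sets glued from geodesics\<close>

lemma far_geodesic_tail:
  assumes x: "x \<in> V" and w: "w \<in> V" "w' \<in> V" "lt x w'"
    and w_or: "w = x \<or> lt x w \<and> lt w w'"
  shows "\<exists>T. finite T \<and> T \<subseteq> V \<and> w \<in> T \<and> w' \<in> T \<and> (\<forall>t\<in>T. (w, t) \<in> (E \<inter> T \<times> T)\<^sup>*) \<and>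
    (\<forall>t\<in>T. d x w \<le> Suc (d x t)) \<and> (\<forall>t\<in>T. 2 \<le> d x t \<longrightarrow> lt x t)"
proof -
  let ?m = "d x w'"
  obtain g where g: "g 0 = x" "g ?m = w'"
    "\<And>i. i < ?m \<Longrightarrow> (g i, g (Suc i)) \<in> E" "\<And>i. i \<le> ?m \<Longrightarrow> d x (g i) = i"
    using geodesic_exists[OF reach[OF x w(2)]] by blast
  have "\<exists>j\<le>?m. (g j = w \<or> (g j, w) \<in> E) \<and> d x w \<le> Suc j"
  proof (cases "w = x")
    case True
    then show ?thesis using g(1) by auto
  next
    case False
    then show ?thesis using w_or geodesic_meets_nbhd[OF x w(2) w(1) _ _ g] by blast
  qed
  then obtain j where j: "j \<le> ?m" "g j = w \<or> (g j, w) \<in> E" "d x w \<le> Suc j" by blast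
  \<comment> \<open>The part of the geodesic before index \<open>j\<close> is dropped. What remains
    is at distance at least \<open>d x w - 1\<close> from \<open>x\<close>, so that later only
    finitely many such pieces come near \<open>x\<close>.\<close>
  define T where "T = insert w (g ` {j..?m})"
  have gV: "g i \<in> V" if "i \<le> ?m" for i
    using that g(3)[of i] g(2) w(2) by (cases "i = ?m") (auto dest: E_vertices)
  \<comment> \<open>The induction runs down from \<open>w'\<close>, the end of the geodesic known to
    lie above \<open>x\<close>; \<open>adjacent_above\<close> carries the property back one step at
    a time.\<close>
  have above: "2 \<le> i \<longrightarrow> lt x (g i)" if "i \<le> ?m" for i
    using that
  proof (induction i rule: inc_induct)
    case base
    then show ?case using g(2) w by simp
  next
    case (step n)
    then show ?case using adjacent_above[OF x g(3)[of n]] g(4)[of n] by auto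
  qed
  have "(w, g i) \<in> (E \<inter> T \<times> T)\<^sup>*" if "j \<le> i" "i \<le> ?m" for i
    using that
  proof (induction i rule: dec_induct)
    case base
    then have "g j = w \<or> (w, g j) \<in> E \<inter> T \<times> T" using j by (auto simp: T_def E_sym)
    then show ?case by auto
  next
    case (step n)
    then have "(g n, g (Suc n)) \<in> E \<inter> T \<times> T" using g(3)[of n] by (auto simp: T_def)
    then show ?case using step by (meson Suc_leD rtrancl.rtrancl_into_rtrancl)
  qed
  then have "\<forall>t\<in>T. (w, t) \<in> (E \<inter> T \<times> T)\<^sup>*" by (auto simp: T_def)
  moreover have "finite T" "T \<subseteq> V" "w \<in> T" using w gV by (auto simp: T_def)
  moreover have "w' \<in> T"
    unfolding T_def using j(1) g(2) by (metis atLeastAtMost_iff imageI insertI2 le_refl)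
  moreover have "\<forall>t\<in>T. d x w \<le> Suc (d x t)" using j(3) g(4) by (auto simp: T_def)
  moreover have "\<forall>t\<in>T. 2 \<le> d x t \<longrightarrow> lt x t"
    using w_or g(4) above by (auto simp: T_def)
  ultimately show ?thesis by blast
qed

text \<open>\<open>C\<close> prescribes extra neighbours to be included at arbitrarily far vertices
  of \<open>S\<close>: none to get just a ray, three each to force branching inside
  \<open>W\<close>. The chosen vertices \<open>w k\<close> are joined in succession by geodesic
  tails.\<close>

lemma thin_connected_set:
  assumes x: "x \<in> V" and S: "S \<subseteq> V" and far: "\<And>n. \<exists>s\<in>S. lt x s \<and> n \<le> d x s"
    and C: "\<And>s. s \<in> S \<Longrightarrow> finite (C s) \<and> C s \<subseteq> E `` {s}"
  shows "\<exists>W. W \<subseteq> V \<and> x \<in> W \<and> (\<forall>n. finite {v \<in> W. d x v \<le> n}) \<and>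
    (\<forall>v\<in>W. (x, v) \<in> (E \<inter> W \<times> W)\<^sup>*) \<and> (\<forall>v\<in>W. 2 \<le> d x v \<longrightarrow> lt x v) \<and>
    (\<forall>n. \<exists>s\<in>S \<inter> W. n \<le> d x s \<and> C s \<subseteq> W)"
proof -
  let ?P = "\<lambda>k v. (k = 0 \<longrightarrow> v = x) \<and> (k \<noteq> 0 \<longrightarrow> v \<in> S \<and> lt x v)"
  \<comment> \<open>The gap of 2 is what \<open>layers_ordered\<close> needs to place
    \<open>w k\<close> below \<open>w (Suc k)\<close> for \<open>k > 0\<close>.\<close>
  let ?Q = "\<lambda>k v u. d x v + 2 \<le> d x u"
  have "\<exists>w. \<forall>k::nat. ?P k (w k) \<and> ?Q k (w k) (w (Suc k))"
  proof (rule dependent_nat_choice)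
    fix v and k :: nat
    show "\<exists>u. ?P (Suc k) u \<and> ?Q k v u" using far[of "d x v + 2"] by auto
  qed simp
  then obtain w where w: "\<And>k. ?P k (w k)" "\<And>k. d x (w k) + 2 \<le> d x (w (Suc k))" by blast
  have w0: "w 0 = x" and wS: "w (Suc k) \<in> S" "lt x (w (Suc k))" for k
    using w(1)[of 0] w(1)[of "Suc k"] by auto
  have wV: "w k \<in> V" for k using w0 wS S x by (cases k) auto
  have wd: "k \<le> d x (w k)" for k
    by (induction k) (use w(2) in \<open>auto intro: order_trans[OF _ w(2)]\<close>)
  have "\<exists>T. finite T \<and> T \<subseteq> V \<and> w k \<in> T \<and> w (Suc k) \<in> T \<and> (\<forall>t\<in>T. (w k, t) \<in> (E \<inter> T \<times> T)\<^sup>*) \<and>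
    (\<forall>t\<in>T. d x (w k) \<le> Suc (d x t)) \<and> (\<forall>t\<in>T. 2 \<le> d x t \<longrightarrow> lt x t)" for k
  proof (rule far_geodesic_tail[OF x wV wV wS(2)])
    show "w k = x \<or> lt x (w k) \<and> lt (w k) (w (Suc k))"
      using w0 wS layers_ordered[OF x wV wV _ wS(2) w(2)] by (cases k) auto
  qed
  then obtain T where T: "\<And>k. finite (T k)" "\<And>k. T k \<subseteq> V" "\<And>k. w k \<in> T k" "\<And>k. w (Suc k) \<in> T k"
    "\<And>k t. t \<in> T k \<Longrightarrow> (w k, t) \<in> (E \<inter> T k \<times> T k)\<^sup>*"
    "\<And>k t. t \<in> T k \<Longrightarrow> d x (w k) \<le> Suc (d x t)"
    "\<And>k t. t \<in> T k \<Longrightarrow> 2 \<le> d x t \<Longrightarrow> lt x t"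
    by metis
  define W where "W = (\<Union>k. T k) \<union> (\<Union>k. C (w (Suc k)))"
  have TW: "T k \<subseteq> W" for k by (auto simp: W_def)
  have CE: "(w (Suc k), c) \<in> E" if "c \<in> C (w (Suc k))" for k c using C[OF wS(1)] that by blast
  have "W \<subseteq> V" using T(2) CE E_vertices by (force simp: W_def)
  have wW: "w k \<in> W" for k using T(3) TW by blast
  then have "x \<in> W" using w0 by metis
  have reach_w: "(x, w k) \<in> (E \<inter> W \<times> W)\<^sup>*" for k
  proof (induction k)
    case 0
    then show ?case using w0 by simp
  next
    case (Suc k)
    have "(w k, w (Suc k)) \<in> (E \<inter> W \<times> W)\<^sup>*"
      using T(5)[OF T(4)] rtrancl_mono[of "E \<inter> T k \<times> T k" "E \<inter> W \<times> W"] TW by blast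
    then show ?case using Suc by (rule rtrancl_trans[rotated])
  qed
  have "(x, v) \<in> (E \<inter> W \<times> W)\<^sup>*" if vW: "v \<in> W" for v
  proof -
    consider k where "v \<in> T k" | k where "v \<in> C (w (Suc k))" using vW by (auto simp: W_def)
    then show ?thesis
    proof cases
      case 1
      then have "(w k, v) \<in> (E \<inter> W \<times> W)\<^sup>*"
        using T(5)[OF 1] rtrancl_mono[of "E \<inter> T k \<times> T k" "E \<inter> W \<times> W"] TW by blast
      then show ?thesis using reach_w by (rule rtrancl_trans[rotated])
    next
      case 2
      then have "(w (Suc k), v) \<in> E \<inter> W \<times> W" using CE wW vW by auto
      then show ?thesis using reach_w by (meson rtrancl.rtrancl_into_rtrancl)
    qed
  qed
  moreover have "lt x v" if vW: "v \<in> W" and v2: "2 \<le> d x v" for v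
  proof -
    consider k where "v \<in> T k" | k where "v \<in> C (w (Suc k))" using vW by (auto simp: W_def)
    then show ?thesis
    proof cases
      case 1
      then show ?thesis using T(7) v2 by blast
    next
      case 2
      then show ?thesis using adjacent_above[OF x E_sym[OF CE] wS(2)] v2 by blast
    qed
  qed
  moreover have "finite {v \<in> W. d x v \<le> n}" for n
  proof (rule finite_subset)
    \<comment> \<open>Vertices of \<open>T k\<close> have distance at least \<open>k - 1\<close>
      from \<open>x\<close>, and those of \<open>C (w (Suc k))\<close> at least \<open>k\<close>;
      hence only indices up to \<open>Suc n\<close> contribute.\<close>
    show "{v \<in> W. d x v \<le> n} \<subseteq> (\<Union>k\<le>Suc n. T k \<union> C (w (Suc k)))"
    proof
      fix v assume v: "v \<in> {v \<in> W. d x v \<le> n}"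
      then consider k where "v \<in> T k" | k where "v \<in> C (w (Suc k))" by (auto simp: W_def)
      then show "v \<in> (\<Union>k\<le>Suc n. T k \<union> C (w (Suc k)))"
      proof cases
        case 1
        then have "k \<le> Suc n" using T(6)[OF 1] wd[of k] v by auto
        then show ?thesis using 1 by blast
      next
        case 2
        then have "d x (w (Suc k)) \<le> Suc (d x v)" using d_step[OF x E_sym[OF CE]] by blast
        then have "k \<le> Suc n" using wd[of "Suc k"] v by auto
        then show ?thesis using 2 by blast
      qed
    qed
    show "finite (\<Union>k\<le>Suc n. T k \<union> C (w (Suc k)))" using T(1) C[OF wS(1)] by auto
  qed
  moreover have "\<exists>s\<in>S \<inter> W. n \<le> d x s \<and> C s \<subseteq> W" for n
    using wS(1)[of n] wW[of "Suc n"] wd[of "Suc n"]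
    by (intro bexI[of _ "w (Suc n)"]) (auto simp: W_def)
  ultimately show ?thesis using \<open>W \<subseteq> V\<close> \<open>x \<in> W\<close> by blast
qed

section \<open>Geodesic rays in thin sets and their teeth\<close>

lemma thin_geodesic_ray:
  assumes x: "x \<in> W" and W: "W \<subseteq> V" and thin: "\<And>n. finite {v \<in> W. d x v \<le> n}"
    and conn: "\<forall>v\<in>W. (x, v) \<in> (E \<inter> W \<times> W)\<^sup>*" and inf: "infinite W"
  shows "\<exists>f. f 0 = x \<and> range f \<subseteq> W \<and> (\<forall>n. rel_dist (E \<inter> W \<times> W) x (f n) = n) \<and>
    (\<forall>i j. (f i, f j) \<in> E \<longleftrightarrow> \<bar>int i - int j\<bar> = 1) \<and> inj f \<and> (\<forall>n. \<exists>i. n \<le> d x (f i))"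
proof -
  let ?F = "E \<inter> W \<times> W"
  have xV: "x \<in> V" using x W by blast
  \<comment> \<open>Thinness makes the induced graph locally finite: an edge raises the distance
    from \<open>x\<close> by at most one, so all neighbours of \<open>v\<close> in \<open>W\<close>
    lie in one finite ball.\<close>
  have "finite (?F `` {v})" for v
    by (rule finite_subset[OF _ thin[of "Suc (d x v)"]]) (auto intro: d_step[OF xV])
  moreover have "W \<subseteq> ?F\<^sup>* `` {x}" using conn by blast
  then have "infinite (?F\<^sup>* `` {x})" using inf finite_subset by blast
  ultimately obtain f where f: "f 0 = x" "\<And>n. (f n, f (Suc n)) \<in> ?F" "\<And>n. rel_dist ?F x (f n) = n"
    using geodesic_ray_exists[of ?F x] by blast
  have fW: "f n \<in> W" for n using f(2)[of n] by blast
  have "inj f" by (rule injI) (metis f(3))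
  \<comment> \<open>Being geodesic for \<open>?F\<close> excludes chords: adjacent vertices of
    \<open>W\<close> differ by at most one in \<open>?F\<close>-distance from \<open>x\<close>,
    which on the ray is the index.\<close>
  have "(f i, f j) \<in> E \<longleftrightarrow> \<bar>int i - int j\<bar> = 1" for i j
  proof
    assume E: "(f i, f j) \<in> E"
    then have "(f i, f j) \<in> ?F" "(f j, f i) \<in> ?F" using fW E_sym by auto
    then have "j \<le> Suc i" "i \<le> Suc j" using rel_dist_step_le[of x _ ?F] bspec[OF conn fW] f(3) by metis+
    moreover have "i \<noteq> j" using E by (auto simp: E_iff)
    ultimately show "\<bar>int i - int j\<bar> = 1" by linarith
  next
    assume "\<bar>int i - int j\<bar> = 1"
    then have "j = Suc i \<or> i = Suc j" by linarith
    then show "(f i, f j) \<in> E" using f(2) E_sym by blast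
  qed
  \<comment> \<open>The distance \<open>d\<close> in the whole graph can be smaller than that inside
    \<open>W\<close>, so unboundedness does not follow from the index; it holds since an injective
    ray cannot stay in a finite ball of \<open>W\<close>.\<close>
  moreover have "\<exists>i. n \<le> d x (f i)" for n
  proof (rule ccontr)
    assume "\<not> ?thesis"
    then have "range f \<subseteq> {v \<in> W. d x v \<le> n}" using fW by (auto simp: not_le less_imp_le)
    then show False using thin[of n] \<open>inj f\<close> finite_subset range_inj_infinite by blast
  qed
  ultimately show ?thesis using f fW \<open>inj f\<close> by blast
qed

text \<open>A far branching vertex on the ray has at most two neighbours there, hence one off it. A
  far one off the ray lies between \<open>x\<close> and some \<open>f m\<close>, so the ray passes
  next to it.\<close>

lemma far_attached_vertex:
  assumes x: "x \<in> V" and W: "W \<subseteq> V" and above: "\<And>v. v \<in> W \<Longrightarrow> 2 \<le> d x v \<Longrightarrow> lt x v"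
    and f: "f 0 = x" "range f \<subseteq> W" "\<And>i j. (f i, f j) \<in> E \<longleftrightarrow> \<bar>int i - int j\<bar> = 1"
      "\<And>n. \<exists>i. n \<le> d x (f i)"
    and branch: "\<And>n. \<exists>s\<in>W. n \<le> d x s \<and> (\<exists>C. card C = 3 \<and> C \<subseteq> W \<inter> E `` {s})"
  shows "\<exists>y\<in>W - range f. (\<exists>i. (y, f i) \<in> E) \<and> n \<le> d x y"
proof -
  \<comment> \<open>The surplus of 2 ensures that \<open>s\<close> lies above \<open>x\<close> and
    also pays for the step from \<open>s\<close> to a neighbour.\<close>
  obtain s C where s: "s \<in> W" "n + 2 \<le> d x s" "card C = 3" "C \<subseteq> W \<inter> E `` {s}"
    using branch[of "n + 2"] by blast
  show ?thesis
  proof (cases "s \<in> range f")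
    case True
    then obtain k where k: "s = f k" by blast
    \<comment> \<open>For \<open>k = 0\<close> truncated subtraction makes \<open>k - 1\<close>
      equal to 0; the set still contains all ray neighbours of \<open>f k\<close>.\<close>
    have "\<not> C \<subseteq> {f (k - 1), f (Suc k)}"
    proof
      assume "C \<subseteq> {f (k - 1), f (Suc k)}"
      then have "card C \<le> card {f (k - 1), f (Suc k)}" by (intro card_mono) auto
      also have "\<dots> \<le> 2" by (simp add: card_insert_if)
      finally show False using s(3) by simp
    qed
    then obtain c where c: "c \<in> C" "c \<notin> {f (k - 1), f (Suc k)}" by blast
    then have cE: "(f k, c) \<in> E" "c \<in> W" using s(4) k by auto
    have "c \<notin> range f"
    proof
      assume "c \<in> range f"
      then obtain j where j: "c = f j" by blast
      then have "\<bar>int k - int j\<bar> = 1" using cE f(3) by blast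
      then have "j = k - 1 \<or> j = Suc k" by linarith
      then show False using c(2) j by auto
    qed
    moreover have "n \<le> d x c" using d_step[OF x E_sym[OF cE(1)]] s(2) k by simp
    ultimately show ?thesis using cE E_sym by blast
  next
    case False
    obtain m where m: "d x s + 2 \<le> d x (f m)" using f(4) by blast
    have mW: "f m \<in> W" using f(2) by blast
    have xs: "lt x s" "lt x (f m)" using above s(1,2) m mW by auto
    then have "lt s (f m)" using layers_ordered[OF x _ _ _ _ m] s(1) mW W by blast
    moreover have "(f i, f (Suc i)) \<in> E" for i using f(3) by simp
    ultimately obtain i where "f i = s \<or> (f i, s) \<in> E"
      using walk_meets_nbhd[of m f s] xs f(1) s(1) W by blast
    then show ?thesis using False s E_sym by (intro bexI[of _ s]) auto
  qed
qed

text \<open>The teeth get a common attachment pattern by pigeonhole and are then thinned out until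
  they are independent and far apart.\<close>

lemma separated_teeth:
  assumes x: "x \<in> V" and W: "W \<subseteq> V" and thin: "\<And>n. finite {v \<in> W. d x v \<le> n}"
    and conn: "\<forall>v\<in>W. (x, v) \<in> (E \<inter> W \<times> W)\<^sup>*"
    and f: "range f \<subseteq> W" "\<And>n. rel_dist (E \<inter> W \<times> W) x (f n) = n"
    and far: "\<And>n. \<exists>y\<in>W - range f. (\<exists>i. (y, f i) \<in> E) \<and> n \<le> d x y"
  shows "\<exists>Y a \<tau>. infinite Y \<and> Y \<subseteq> W - range f \<and> (\<forall>y\<in>Y. \<forall>y'\<in>Y. (y, y') \<notin> E) \<and>
    0 \<in> \<tau> \<and> \<tau> \<subseteq> {0, 1, 2} \<and> (\<forall>y\<in>Y. \<forall>i. (y, f i) \<in> E \<longleftrightarrow> (\<exists>t\<in>\<tau>. i = a y + t)) \<and>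
    (\<forall>y\<in>Y. 2 \<le> a y) \<and> (\<forall>y\<in>Y. \<forall>y'\<in>Y. y \<noteq> y' \<longrightarrow> a y + 4 \<le> a y' \<or> a y' + 4 \<le> a y)"
proof -
  let ?F = "E \<inter> W \<times> W"
  define Y0 where "Y0 = {y \<in> W - range f. \<exists>i. (y, f i) \<in> E}"
  define a where "a y = (LEAST i. (y, f i) \<in> E)" for y
  \<comment> \<open>Positions of the ray neighbours of \<open>y\<close>, counted from the first one,
    \<open>f (a y)\<close>.\<close>
  define \<tau> where "\<tau> y = {t. (y, f (a y + t)) \<in> E}" for y
  have fW: "f i \<in> W" for i using f(1) by blast
  have Fstep: "rel_dist ?F x v \<le> Suc (rel_dist ?F x u)" if "(u, v) \<in> E" "u \<in> W" "v \<in> W" for u v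
    using rel_dist_step_le[of x u ?F v] conn that by blast
  have a_adj: "(y, f (a y)) \<in> E" if "y \<in> Y0" for y
    unfolding a_def using that by (auto simp: Y0_def intro: LeastI)
  have a_le: "a y \<le> i" if "(y, f i) \<in> E" for y i
    unfolding a_def using that by (rule Least_le)
  \<comment> \<open>Going from \<open>f (a y)\<close> over \<open>y\<close> to \<open>f i\<close>
    raises the \<open>?F\<close>-distance by at most 2, and on the ray that distance is the
    index.\<close>
  have window: "i \<le> a y + 2" if "y \<in> Y0" "(y, f i) \<in> E" for y i
  proof -
    have "y \<in> W" using that by (simp add: Y0_def)
    then show ?thesis
      using Fstep[OF that(2) _ fW] Fstep[OF E_sym[OF a_adj[OF that(1)]] fW] f(2)[of i] f(2)[of "a y"]
      by simp
  qed
  have Y0_inf: "infinite Y0"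
    using far unfolding Y0_def by (intro unbounded_imp_infinite[where d = "d x"]) blast
  have \<tau>_sub: "\<tau> y \<subseteq> {0, 1, 2}" if "y \<in> Y0" for y
    using window[OF that] by (fastforce simp: \<tau>_def)
  have "\<tau> ` Y0 \<subseteq> Pow {0, 1, 2}" using \<tau>_sub by blast
  then have "finite (\<tau> ` Y0)" using finite_subset by blast
  then obtain y0 where y0: "y0 \<in> Y0" "infinite {y \<in> Y0. \<tau> y = \<tau> y0}"
    using pigeonhole_infinite[OF Y0_inf, of \<tau>] by blast
  define Y1 where "Y1 = {y \<in> Y0. \<tau> y = \<tau> y0}"
  \<comment> \<open>If \<open>a\<close> were bounded on \<open>Y1\<close>, all these vertices would
    be next to an initial segment of the ray, hence in a finite ball of \<open>W\<close>.\<close>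
  have Y1: "\<exists>y\<in>Y1. n \<le> a y" for n
  proof (rule ccontr)
    assume no: "\<not> ?thesis"
    define M where "M = Max (d x ` f ` {..n})"
    have "Y1 \<subseteq> {v \<in> W. d x v \<le> Suc M}"
    proof
      fix y assume y: "y \<in> Y1"
      then have "a y \<le> n" using no by force
      then have "d x (f (a y)) \<le> M" unfolding M_def by (intro Max_ge) auto
      moreover have "d x y \<le> Suc (d x (f (a y)))"
        using y a_adj E_sym d_step[OF x] by (auto simp: Y1_def)
      ultimately show "y \<in> {v \<in> W. d x v \<le> Suc M}" using y by (auto simp: Y1_def Y0_def)
    qed
    then show False using thin y0(2) finite_subset by (auto simp: Y1_def)
  qed
  \<comment> \<open>A gap of 4 exceeds the index change of at most 3 along a path from ray to tooth
    to tooth to ray, so the chosen teeth are non-adjacent. Starting at 2 keeps \<open>f 0\<close>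
    and \<open>f 1\<close> clear of teeth.\<close>
  have "\<exists>h. \<forall>k::nat. (h k \<in> Y1 \<and> 2 \<le> a (h k)) \<and> a (h k) + 4 \<le> a (h (Suc k))"
  proof (rule dependent_nat_choice)
    show "\<exists>y. y \<in> Y1 \<and> 2 \<le> a y" using Y1 by blast
    show "\<exists>y'. (y' \<in> Y1 \<and> 2 \<le> a y') \<and> a y + 4 \<le> a y'" for y
      using Y1[of "a y + 4"] by force
  qed
  then obtain h where h: "\<And>k. h k \<in> Y1" "\<And>k. 2 \<le> a (h k)" "\<And>k. a (h k) + 4 \<le> a (h (Suc k))"
    by blast
  have sep: "a (h i) + 4 \<le> a (h j)" if "i < j" for i j
    using that
  proof (induction j)
    case (Suc j)
    then show ?case using h(3)[of j] by (cases "i = j") auto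
  qed simp
  have hY0: "h k \<in> Y0" for k using h(1) by (simp add: Y1_def)
  have "inj h"
    by (rule linorder_injI) (use sep in fastforce)
  then have "infinite (range h)" by (rule range_inj_infinite)
  moreover have "range h \<subseteq> W - range f" using hY0 by (auto simp: Y0_def)
  moreover have "(h i, h j) \<notin> E" for i j
  proof -
    have less: "(h i, h j) \<notin> E" if "i < j" for i j
    proof
      assume E: "(h i, h j) \<in> E"
      have hW: "h i \<in> W" "h j \<in> W" using hY0 by (auto simp: Y0_def)
      have "a (h j) \<le> a (h i) + 3"
        using Fstep[OF E_sym[OF a_adj[OF hY0[of i]]] fW hW(1)] Fstep[OF E hW]
          Fstep[OF a_adj[OF hY0[of j]] hW(2) fW] f(2) by simp
      then show False using sep[OF that] by simp
    qed
    show ?thesis using less[of i j] less[of j i] E_sym by (metis E_iff nat_neq_iff)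
  qed
  moreover have "0 \<in> \<tau> y0" using a_adj[OF y0(1)] by (simp add: \<tau>_def)
  moreover have "(h k, f i) \<in> E \<longleftrightarrow> (\<exists>t\<in>\<tau> y0. i = a (h k) + t)" for k i
  proof -
    have "\<tau> y0 = \<tau> (h k)" using h(1) by (simp add: Y1_def)
    then show ?thesis using a_le[of "h k" i] by (auto simp: \<tau>_def le_iff_add)
  qed
  moreover have "h i \<noteq> h j \<longrightarrow> a (h i) + 4 \<le> a (h j) \<or> a (h j) + 4 \<le> a (h i)" for i j
    using sep[of i j] sep[of j i] by (metis nat_neq_iff)
  ultimately show ?thesis
    using \<tau>_sub[OF y0(1)] h(2) by (intro exI[of _ "range h"] exI[of _ a] exI[of _ "\<tau> y0"]) auto
qed

text \<open>Every vertex far from \<open>x\<close> is comparable to \<open>x\<close>, and the graph of the dual order is the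
  same, so it suffices to treat the case of far vertices above \<open>x\<close>.\<close>

lemma dual_incomparability: "incomparability V (\<lambda>a b. lt b a) E"
  using lt_trans lt_irrefl E_iff reach by unfold_locales blast+

lemma far_above_or_below:
  assumes x: "x \<in> V" and S: "S \<subseteq> V" and far: "\<And>n. \<exists>s\<in>S. n \<le> d x s"
  shows "(\<forall>n. \<exists>s\<in>S. lt x s \<and> n \<le> d x s) \<or> (\<forall>n. \<exists>s\<in>S. lt s x \<and> n \<le> d x s)"
proof (rule ccontr)
  assume "\<not> ?thesis"
  then obtain m n where mn: "\<And>s. s \<in> S \<Longrightarrow> lt x s \<Longrightarrow> \<not> m \<le> d x s"
    "\<And>s. s \<in> S \<Longrightarrow> lt s x \<Longrightarrow> \<not> n \<le> d x s" by blast
  obtain s where "s \<in> S" "m + n + 2 \<le> d x s" using far by blast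
  then show False using far_comparable[OF x, of s] S mn[of s] by auto
qed

section \<open>Rays and toothed rays from a given vertex\<close>

lemma far_ray_above:
  assumes x: "x \<in> V" and S: "S \<subseteq> V" and far: "\<And>n. \<exists>s\<in>S. lt x s \<and> n \<le> d x s"
  shows "\<exists>f. f 0 = x \<and> range f \<subseteq> V \<and> inj f \<and>
    (\<forall>i j. (f i, f j) \<in> E \<longleftrightarrow> \<bar>int i - int j\<bar> = 1) \<and> (\<forall>n. \<exists>i. n \<le> d x (f i))"
proof -
  obtain W where W: "W \<subseteq> V" "x \<in> W" "\<And>n. finite {v \<in> W. d x v \<le> n}"
    "\<forall>v\<in>W. (x, v) \<in> (E \<inter> W \<times> W)\<^sup>*" "\<And>n. \<exists>s\<in>S \<inter> W. n \<le> d x s"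
    using thin_connected_set[OF x S far, of "\<lambda>_. {}"] by auto
  have "infinite W" by (rule unbounded_imp_infinite[where d = "d x"]) (use W(5) in blast)
  then obtain f where "f 0 = x" "range f \<subseteq> W" "\<forall>i j. (f i, f j) \<in> E \<longleftrightarrow> \<bar>int i - int j\<bar> = 1"
    "inj f" "\<forall>n. \<exists>i. n \<le> d x (f i)"
    using thin_geodesic_ray[OF W(2,1,3,4)] by blast
  moreover from this W(1) have "range f \<subseteq> V" by blast
  ultimately show ?thesis by blast
qed

lemma toothed_ray_above:
  assumes x: "x \<in> V" and S: "S \<subseteq> V" and far: "\<And>n. \<exists>s\<in>S. lt x s \<and> n \<le> d x s"
    and branch: "\<forall>s\<in>S. \<exists>C. card C = 3 \<and> C \<subseteq> E `` {s}"
  shows "\<exists>f Y a \<tau>. f 0 = x \<and> range f \<subseteq> V \<and> inj f \<and>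
    (\<forall>i j. (f i, f j) \<in> E \<longleftrightarrow> \<bar>int i - int j\<bar> = 1) \<and> (\<forall>n. \<exists>i. n \<le> d x (f i)) \<and>
    infinite Y \<and> Y \<subseteq> V - range f \<and> (\<forall>y\<in>Y. \<forall>y'\<in>Y. (y, y') \<notin> E) \<and>
    0 \<in> \<tau> \<and> \<tau> \<subseteq> {0, 1, 2} \<and> (\<forall>y\<in>Y. \<forall>i. (y, f i) \<in> E \<longleftrightarrow> (\<exists>t\<in>\<tau>. i = a y + t)) \<and>
    (\<forall>y\<in>Y. 2 \<le> a y) \<and> (\<forall>y\<in>Y. \<forall>y'\<in>Y. y \<noteq> y' \<longrightarrow> a y + 4 \<le> a y' \<or> a y' + 4 \<le> a y)"
proof -
  obtain C where C: "\<And>s. s \<in> S \<Longrightarrow> card (C s) = 3 \<and> C s \<subseteq> E `` {s}" using branch by metis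
  \<comment> \<open>Since \<open>card\<close> is 0 on infinite sets, cardinality 3 includes
    finiteness.\<close>
  then have "\<And>s. s \<in> S \<Longrightarrow> finite (C s) \<and> C s \<subseteq> E `` {s}"
    by (metis card.infinite zero_neq_numeral)
  then obtain W where W: "W \<subseteq> V" "x \<in> W" "\<And>n. finite {v \<in> W. d x v \<le> n}"
    "\<forall>v\<in>W. (x, v) \<in> (E \<inter> W \<times> W)\<^sup>*" "\<And>v. v \<in> W \<Longrightarrow> 2 \<le> d x v \<Longrightarrow> lt x v"
    "\<And>n. \<exists>s\<in>S \<inter> W. n \<le> d x s \<and> C s \<subseteq> W"
    using thin_connected_set[OF x S far, of C] by auto
  have "infinite W" by (rule unbounded_imp_infinite[where d = "d x"]) (use W(6) in blast)
  then obtain f where f: "f 0 = x" "range f \<subseteq> W" "\<And>n. rel_dist (E \<inter> W \<times> W) x (f n) = n"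
    "\<forall>i j. (f i, f j) \<in> E \<longleftrightarrow> \<bar>int i - int j\<bar> = 1" "inj f" "\<forall>n. \<exists>i. n \<le> d x (f i)"
    using thin_geodesic_ray[OF W(2,1,3,4)] by blast
  have "\<exists>s\<in>W. n \<le> d x s \<and> (\<exists>C. card C = 3 \<and> C \<subseteq> W \<inter> E `` {s})" for n
    using W(6)[of n] C by blast
  then have "\<exists>y\<in>W - range f. (\<exists>i. (y, f i) \<in> E) \<and> n \<le> d x y" for n
    using far_attached_vertex[OF x W(1,5) f(1,2) f(4)[rule_format] f(6)[rule_format]] by blast
  from separated_teeth[OF x W(1,3,4) f(2,3) this]
  obtain Y a \<tau> where Y: "infinite Y" "Y \<subseteq> W - range f" "\<forall>y\<in>Y. \<forall>y'\<in>Y. (y, y') \<notin> E"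
    "0 \<in> \<tau>" "\<tau> \<subseteq> {0, 1, 2}" "\<forall>y\<in>Y. \<forall>i. (y, f i) \<in> E \<longleftrightarrow> (\<exists>t\<in>\<tau>. i = a y + t)"
    "\<forall>y\<in>Y. 2 \<le> a y" "\<forall>y\<in>Y. \<forall>y'\<in>Y. y \<noteq> y' \<longrightarrow> a y + 4 \<le> a y' \<or> a y' + 4 \<le> a y"
    by (elim exE conjE) (rule that)
  have "range f \<subseteq> V" "Y \<subseteq> V - range f" using W(1) f(2) Y(2) by blast+
  then show ?thesis
    by (intro exI[of _ f] exI[of _ Y] exI[of _ a] exI[of _ \<tau>] conjI)
      (assumption | rule f(1,4,5,6) Y(1,3-8))+
qed

lemma far_ray_exists:
  assumes "x \<in> V" "S \<subseteq> V" "\<And>n. \<exists>s\<in>S. n \<le> d x s"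
  shows "\<exists>f. f 0 = x \<and> range f \<subseteq> V \<and> inj f \<and>
    (\<forall>i j. (f i, f j) \<in> E \<longleftrightarrow> \<bar>int i - int j\<bar> = 1) \<and> (\<forall>n. \<exists>i. n \<le> d x (f i))"
proof -
  interpret dual: incomparability V "\<lambda>a b. lt b a" E by (rule dual_incomparability)
  from far_above_or_below[OF assms] show ?thesis
  proof
    assume "\<forall>n. \<exists>s\<in>S. lt x s \<and> n \<le> d x s"
    then show ?thesis by (intro far_ray_above[OF assms(1,2)]) blast
  next
    assume "\<forall>n. \<exists>s\<in>S. lt s x \<and> n \<le> d x s"
    then show ?thesis by (intro dual.far_ray_above[OF assms(1,2)]) blast
  qed
qed

lemma toothed_ray_exists:
  assumes "x \<in> V" "S \<subseteq> V" "\<And>n. \<exists>s\<in>S. n \<le> d x s"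
    and branch: "\<forall>s\<in>S. \<exists>C. card C = 3 \<and> C \<subseteq> E `` {s}"
  shows "\<exists>f Y a \<tau>. f 0 = x \<and> range f \<subseteq> V \<and> inj f \<and>
    (\<forall>i j. (f i, f j) \<in> E \<longleftrightarrow> \<bar>int i - int j\<bar> = 1) \<and> (\<forall>n. \<exists>i. n \<le> d x (f i)) \<and>
    infinite Y \<and> Y \<subseteq> V - range f \<and> (\<forall>y\<in>Y. \<forall>y'\<in>Y. (y, y') \<notin> E) \<and>
    0 \<in> \<tau> \<and> \<tau> \<subseteq> {0, 1, 2} \<and> (\<forall>y\<in>Y. \<forall>i. (y, f i) \<in> E \<longleftrightarrow> (\<exists>t\<in>\<tau>. i = a y + t)) \<and>
    (\<forall>y\<in>Y. 2 \<le> a y) \<and> (\<forall>y\<in>Y. \<forall>y'\<in>Y. y \<noteq> y' \<longrightarrow> a y + 4 \<le> a y' \<or> a y' + 4 \<le> a y)"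
proof -
  interpret dual: incomparability V "\<lambda>a b. lt b a" E by (rule dual_incomparability)
  from far_above_or_below[OF assms(1-3)] show ?thesis
  proof
    assume "\<forall>n. \<exists>s\<in>S. lt x s \<and> n \<le> d x s"
    then show ?thesis by (intro toothed_ray_above[OF assms(1,2) _ branch]) blast+
  next
    assume "\<forall>n. \<exists>s\<in>S. lt s x \<and> n \<le> d x s"
    then show ?thesis by (intro dual.toothed_ray_above[OF assms(1,2) _ branch]) blast+
  qed
qed

end

section \<open>Rays with teeth are combs or kites\<close>

lemma vertex_degree_eq_1_iff: "vertex_degree G v = 1 \<longleftrightarrow> (\<exists>u. nbhd G v = {u})"
  by (auto simp: vertex_degree_def one_enat_def card_1_singleton_iff)

text \<open>Three-element subsets treat finite and infinite degrees uniformly.\<close>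

lemma vertex_degree_ge_3_iff: "3 \<le> vertex_degree G v \<longleftrightarrow> (\<exists>C. card C = 3 \<and> C \<subseteq> nbhd G v)"
proof
  assume deg: "3 \<le> vertex_degree G v"
  show "\<exists>C. card C = 3 \<and> C \<subseteq> nbhd G v"
  proof (cases "finite (nbhd G v)")
    case True
    then have "3 \<le> card (nbhd G v)" using deg by (simp add: vertex_degree_def numeral_eq_enat)
    then show ?thesis by (meson obtain_subset_with_card_n)
  next
    case False
    then show ?thesis using infinite_arbitrarily_large by metis
  qed
next
  assume "\<exists>C. card C = 3 \<and> C \<subseteq> nbhd G v"
  then show "3 \<le> vertex_degree G v"
    by (auto simp: vertex_degree_def numeral_eq_enat dest: card_mono)
qed

text \<open>The common pattern \<open>\<tau>\<close> decides the type of the result. Windows of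
  three consecutive indices whose starts are 4 apart stay 2 apart, just as the last two kite types
  demand. The bound \<open>2 \<le> a y\<close> gives each first contact a predecessor on the ray and
  leaves \<open>f 1\<close> free.\<close>

locale toothed_ray =
  fixes H :: "'a graph" and f :: "nat \<Rightarrow> 'a" and Y :: "'a set" and a :: "'a \<Rightarrow> nat"
    and \<tau> :: "nat set"
  assumes ext: "ray_extension H f Y"
    and \<tau>: "0 \<in> \<tau>" "\<tau> \<subseteq> {0, 1, 2}"
    and tooth: "y \<in> Y \<Longrightarrow> adjacent H y (f i) \<longleftrightarrow> (\<exists>t\<in>\<tau>. i = a y + t)"
    and a_ge: "y \<in> Y \<Longrightarrow> 2 \<le> a y"
    and sep: "y \<in> Y \<Longrightarrow> y' \<in> Y \<Longrightarrow> y \<noteq> y' \<Longrightarrow> a y + 4 \<le> a y' \<or> a y' + 4 \<le> a y"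
begin

lemma vertices_H: "vertices H = range f \<union> Y" and disj: "range f \<inter> Y = {}"
  and simple: "simple_graph H" and inj_f: "inj f"
  and ray_adj: "adjacent H (f i) (f j) \<longleftrightarrow> \<bar>int i - int j\<bar> = 1"
  and indep: "y \<in> Y \<Longrightarrow> y' \<in> Y \<Longrightarrow> \<not> adjacent H y y'"
  using ext by (auto simp: ray_extension_def induced_ray_def)

lemma adj_commute: "adjacent H u v \<longleftrightarrow> adjacent H v u"
  by (simp add: adjacent_def insert_commute)

lemma nbhd_tooth:
  assumes "y \<in> Y"
  shows "nbhd H y = (\<lambda>t. f (a y + t)) ` \<tau>"
  using tooth[OF assms] indep[OF assms] by (auto simp: nbhd_def vertices_H)

lemma tooth_index:
  assumes "y \<in> Y" "f i \<in> nbhd H y"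
  shows "a y \<le> i" "i \<le> a y + 2"
  using assms \<tau>(2) tooth[OF assms(1), of i] by (auto simp: nbhd_def)

lemma nbhd_ray: "nbhd H (f i) = f ` {j. \<bar>int i - int j\<bar> = 1} \<union> {y \<in> Y. \<exists>t\<in>\<tau>. i = a y + t}"
  using ray_adj tooth adj_commute disj by (auto simp: nbhd_def vertices_H)

lemma nbhds_disjoint:
  assumes "y \<in> Y" "y' \<in> Y" "y \<noteq> y'" "u \<in> nbhd H y"
  shows "u \<notin> nbhd H y'"
proof
  assume u: "u \<in> nbhd H y'"
  obtain i where "u = f i" using nbhd_tooth[OF assms(1)] assms(4) by blast
  then show False
    using tooth_index[OF assms(1)] tooth_index[OF assms(2)] assms(4) u sep[OF assms(1-3)] by fastforce
qed

lemma teeth_far: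
  assumes "y \<in> Y" "y' \<in> Y" "y \<noteq> y'" "f i \<in> nbhd H y" "f i' \<in> nbhd H y'"
  shows "i + 2 \<le> i' \<or> i' + 2 \<le> i"
  using tooth_index[OF assms(1,4)] tooth_index[OF assms(2,5)] sep[OF assms(1-3)] by linarith

lemma nbhd_tooth_inter_ray: "y \<in> Y \<Longrightarrow> nbhd H y \<inter> range f = (\<lambda>t. f (a y + t)) ` \<tau>"
  using nbhd_tooth by auto

lemma kite1:
  assumes "\<tau> = {0, 1}"
  shows "kite1 H"
proof -
  have "\<forall>y\<in>Y. \<exists>i. nbhd H y \<inter> range f = {f i, f (i + 1)}"
    using nbhd_tooth_inter_ray assms by (intro ballI exI[of _ "a _"]) simp
  moreover have "\<forall>y\<in>Y. \<forall>y'\<in>Y. y \<noteq> y' \<longrightarrow>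
    (\<forall>u v. {u, v} \<subseteq> nbhd H y \<inter> nbhd H y' \<inter> range f \<longrightarrow> u = v)"
    using nbhds_disjoint by (metis IntD1 IntD2 insert_subset)
  ultimately show ?thesis
    unfolding kite1_def using ext by (intro exI[of _ f] exI[of _ Y] conjI)
qed

lemma kite2:
  assumes "\<tau> = {0, 1, 2}"
  shows "kite2 H"
proof -
  have "\<forall>y\<in>Y. \<exists>i. nbhd H y \<inter> range f = {f i, f (i + 1), f (i + 2)}"
    using nbhd_tooth_inter_ray assms by (intro ballI exI[of _ "a _"]) simp
  moreover have "\<forall>y\<in>Y. \<forall>y'\<in>Y. y \<noteq> y' \<longrightarrow> (\<forall>i i'. {f i, f (i + 1), f (i + 2)} \<subseteq> nbhd H y \<and>
    {f i', f (i' + 1), f (i' + 2)} \<subseteq> nbhd H y' \<longrightarrow> i + 2 \<le> i' \<or> i' + 2 \<le> i)"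
    using teeth_far by (metis insert_subset)
  ultimately show ?thesis
    unfolding kite2_def using ext by (intro exI[of _ f] exI[of _ Y] conjI)
qed

lemma kite3:
  assumes "\<tau> = {0, 2}"
  shows "kite3 H"
proof -
  have "\<forall>y\<in>Y. \<exists>i. nbhd H y \<inter> range f = {f i, f (i + 2)}"
    using nbhd_tooth_inter_ray assms by (intro ballI exI[of _ "a _"]) simp
  moreover have "\<forall>y\<in>Y. \<forall>y'\<in>Y. y \<noteq> y' \<longrightarrow> (\<forall>i i'. {f i, f (i + 2)} \<subseteq> nbhd H y \<and>
    {f i', f (i' + 2)} \<subseteq> nbhd H y' \<longrightarrow> i + 2 \<le> i' \<or> i' + 2 \<le> i)"
    using teeth_far by (metis insert_subset)
  ultimately show ?thesis
    unfolding kite3_def using ext by (intro exI[of _ f] exI[of _ Y] conjI)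
qed

lemma connected: "connected_graph H"
proof -
  have ray: "(f 0, f n) \<in> (adj_rel H)\<^sup>*" for n
  proof (induction n)
    case (Suc n)
    have "(f n, f (Suc n)) \<in> adj_rel H" by (simp add: adj_rel_iff vertices_H ray_adj)
    then show ?case using Suc by (rule rtrancl_into_rtrancl[rotated])
  qed simp
  have "(f 0, v) \<in> (adj_rel H)\<^sup>*" if "v \<in> vertices H" for v
  proof (cases "v \<in> Y")
    case True
    then have "(f (a v), v) \<in> adj_rel H"
      using tooth[OF True, of "a v"] \<tau>(1) adj_commute by (auto simp: adj_rel_iff vertices_H)
    then show ?thesis using ray by (rule rtrancl_into_rtrancl[rotated])
  next
    case False
    then show ?thesis using that ray by (auto simp: vertices_H)
  qed
  then show ?thesis
    unfolding connected_graph_iff by (meson rtrancl_trans symD sym_adj_rel sym_rtrancl)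
qed

text \<open>The leaves are \<open>f 0\<close> and the teeth, so deleting them leaves the ray from
  \<open>f 1\<close> on. Two teeth have no common neighbour, and \<open>f 1\<close>, the only
  neighbour of \<open>f 0\<close>, meets no tooth.\<close>

lemma comb:
  assumes "\<tau> = {0}"
  shows "comb H"
proof -
  have deg_Y: "vertex_degree H y = 1" if "y \<in> Y" for y
    using nbhd_tooth[OF that] assms by (simp add: vertex_degree_eq_1_iff)
  have "{j. \<bar>int 0 - int j\<bar> = 1} = {1}" by auto
  then have "nbhd H (f 0) = {f 1}" using nbhd_ray[of 0] a_ge by fastforce
  then have deg_0: "vertex_degree H (f 0) = 1" by (simp add: vertex_degree_eq_1_iff)
  have deg_Suc: "vertex_degree H (f (Suc n)) \<noteq> 1" for n
  proof
    assume "vertex_degree H (f (Suc n)) = 1"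
    then obtain u where "nbhd H (f (Suc n)) = {u}" by (auto simp: vertex_degree_eq_1_iff)
    moreover have "f n \<in> nbhd H (f (Suc n))" "f (n + 2) \<in> nbhd H (f (Suc n))"
      by (auto simp: nbhd_ray)
    ultimately have "f n = f (n + 2)" by simp
    then show False using inj_f by (simp add: inj_eq)
  qed
  have leaf: "v \<in> Y \<or> v = f 0" if "v \<in> vertices H" "vertex_degree H v = 1" for v
    using that deg_Suc by (auto simp: vertices_H) (metis not0_implies_Suc)
  let ?S = "{v \<in> vertices H. vertex_degree H v \<noteq> 1}"
  have S: "?S = f ` {1..}"
  proof
    show "?S \<subseteq> f ` {1..}"
    proof
      fix v assume v: "v \<in> ?S"
      then obtain n where "v = f n" using deg_Y by (auto simp: vertices_H)
      moreover from this v deg_0 have "n \<noteq> 0" by (metis (mono_tags) mem_Collect_eq)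
      ultimately show "v \<in> f ` {1..}" by auto
    qed
    show "f ` {1..} \<subseteq> ?S" using deg_Suc by (auto simp: vertices_H) (metis Suc_le_D)
  qed
  have "path_graph (induced_on H ?S)"
    unfolding path_graph_def
  \<comment> \<open>Paths are indexed by integer intervals, so the remaining ray is reindexed
    through \<open>nat\<close> on the integers from 1.\<close>
  proof (intro exI[of _ "{1::int..}"] exI[of _ "\<lambda>i. f (nat i)"] conjI ballI)
    have "bij_betw nat {1::int..} {1..}"
      by (rule bij_betw_byWitness[of _ int]) auto
    moreover have "bij_betw f {1..} ?S"
      unfolding S by (rule bij_betw_imageI) (use inj_f in \<open>auto intro: inj_on_subset\<close>)
    ultimately have "bij_betw (f \<circ> nat) {1::int..} ?S" by (rule bij_betw_trans)
    then show "bij_betw (\<lambda>i. f (nat i)) {1::int..} (vertices (induced_on H ?S))"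
      by (simp add: induced_on_def comp_def)
  next
    fix i j :: int assume ij: "i \<in> {1..}" "j \<in> {1..}"
    then have "f (nat i) \<in> ?S" "f (nat j) \<in> ?S" unfolding S by auto
    then have "adjacent (induced_on H ?S) (f (nat i)) (f (nat j)) \<longleftrightarrow> adjacent H (f (nat i)) (f (nat j))"
      unfolding adjacent_def induced_on_def by auto
    then show "adjacent (induced_on H ?S) (f (nat i)) (f (nat j)) \<longleftrightarrow> \<bar>i - j\<bar> = 1"
      using ij by (auto simp: ray_adj)
  qed auto
  moreover have "u = w" if "v \<in> vertices H" "u \<in> nbhd H v" "w \<in> nbhd H v"
    "vertex_degree H u = 1" "vertex_degree H w = 1" for u v w
  proof -
    have nb: "v \<in> nbhd H u" "v \<in> nbhd H w"
      using that by (auto simp: nbhd_def adj_commute)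
    have uw: "u \<in> Y \<or> u = f 0" "w \<in> Y \<or> w = f 0"
      using leaf that by (auto simp: nbhd_def)
    have far: "\<not> (v \<in> nbhd H y \<and> v \<in> nbhd H (f 0))" if "y \<in> Y" for y
    proof -
      have "f 1 \<notin> nbhd H y" using tooth_index(1)[OF that, of 1] a_ge[OF that] by auto
      then show ?thesis using \<open>nbhd H (f 0) = {f 1}\<close> by auto
    qed
    show ?thesis using uw nb far nbhds_disjoint by metis
  qed
  ultimately show ?thesis
    unfolding comb_def caterpillar_def using simple connected by blast
qed

text \<open>As 0 belongs to \<open>\<tau>\<close>, four patterns remain: \<open>{0}\<close> gives a
  comb, and \<open>{0, 1}\<close>, \<open>{0, 1, 2}\<close>, \<open>{0, 2}\<close> give the three
  kite types in turn.\<close>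

lemma comb_or_kite: "comb H \<or> kite H"
proof -
  have "\<tau> = {0} \<or> \<tau> = {0, 1} \<or> \<tau> = {0, 2} \<or> \<tau> = {0, 1, 2}" using \<tau> by blast
  then show ?thesis using comb kite1 kite2 kite3 by (auto simp: kite_def)
qed

text \<open>Each \<open>f (a y)\<close> is adjacent to its two ray neighbours and to
  \<open>y\<close>, and distinct teeth have distinct first contacts.\<close>

lemma infinite_branching:
  assumes "infinite Y"
  shows "infinite {v \<in> vertices H. 3 \<le> vertex_degree H v}"
proof -
  have "inj_on (\<lambda>y. f (a y)) Y"
    using sep inj_f by (intro inj_onI) (fastforce simp: inj_eq)
  then have "infinite ((\<lambda>y. f (a y)) ` Y)" using assms finite_imageD by blast
  moreover have "3 \<le> vertex_degree H (f (a y))" if y: "y \<in> Y" for y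
  proof -
    obtain k where k: "a y = Suc k" using a_ge[OF y] by (cases "a y") auto
    have "{f k, f (k + 2), y} \<subseteq> nbhd H (f (a y))"
      using y \<tau>(1) k by (auto simp: nbhd_ray intro: bexI[of _ 0])
    moreover have "card {f k, f (k + 2), y} = 3"
      using inj_f disj y by (auto simp: inj_eq card_insert_if)
    ultimately show ?thesis unfolding vertex_degree_ge_3_iff by blast
  qed
  then have "(\<lambda>y. f (a y)) ` Y \<subseteq> {v \<in> vertices H. 3 \<le> vertex_degree H v}"
    by (auto simp: vertices_H)
  ultimately show ?thesis using finite_subset by blast
qed

end

section \<open>Induced subgraphs and the final assembly\<close>

lemma simple_induced_on:
  assumes "simple_graph G"
  shows "simple_graph (induced_on G W)"
  using assms by (auto simp: simple_graph_def induced_on_def)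

lemma adjacent_induced_on:
  "adjacent (induced_on G W) u v \<longleftrightarrow> adjacent G u v \<and> u \<in> W \<and> v \<in> W"
  by (auto simp: adjacent_def induced_on_def)

lemma vertices_induced_on [simp]: "vertices (induced_on G W) = W"
  by (simp add: induced_on_def)

theorem theorem3:
  fixes V :: "'a set" and r :: "'a rel" and G :: "'a graph"
  assumes poset: "partial_order_on V r"
    and G: "G = inc_graph V r"
    and conn: "connected_graph G"
    and diam: "graph_diameter G (vertices G) = \<infinity>"
  shows "(\<forall>x\<in>vertices G. \<exists>f. induced_ray G f \<and> f 0 = x \<and> graph_diameter G (range f) = \<infinity>) \<and>
    (graph_diameter G {v \<in> vertices G. vertex_degree G v \<ge> 3} = \<infinity> \<longrightarrow>
      (\<exists>H. induced_subgraph_of H G \<and> (comb H \<or> kite H) \<and>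
        graph_diameter G (vertices H) = \<infinity> \<and>
        infinite {v \<in> vertices H. vertex_degree H v \<ge> 3}))"
proof -
  let ?E = "adj_rel G"
  have VG: "vertices G = V" by (simp add: G inc_graph_def)
  have r: "(a, a) \<in> r" if "a \<in> V" for a
    using poset that by (auto simp: partial_order_on_def preorder_on_def refl_on_def)
  have adj: "adjacent G a b \<longleftrightarrow> a \<in> V \<and> b \<in> V \<and> (a, b) \<notin> r \<and> (b, a) \<notin> r" for a b
    by (auto simp: G inc_graph_def adjacent_def doubleton_eq_iff)
  \<comment> \<open>The strict part of \<open>r\<close> serves as the order; reflexivity of
    \<open>r\<close> on \<open>V\<close> excludes loops, which matches the condition that adjacent
    vertices differ.\<close>
  interpret incomparability V "\<lambda>a b. (a, b) \<in> r \<and> a \<noteq> b" ?E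
  proof
    show "(a, c) \<in> r \<and> a \<noteq> c" if "(a, b) \<in> r \<and> a \<noteq> b" "(b, c) \<in> r \<and> b \<noteq> c" for a b c
      using poset that unfolding partial_order_on_def preorder_on_def by (metis antisymD transD)
    show "(a, b) \<in> ?E \<longleftrightarrow> a \<in> V \<and> b \<in> V \<and> a \<noteq> b \<and> \<not> ((a, b) \<in> r \<and> a \<noteq> b) \<and> \<not> ((b, a) \<in> r \<and> b \<noteq> a)" for a b
      using r by (auto simp: adj_rel_iff VG adj)
    show "(a, b) \<in> ?E\<^sup>*" if "a \<in> V" "b \<in> V" for a b
      using conn that VG by (simp add: connected_graph_iff)
  qed simp
  have E_adj: "(a, b) \<in> ?E \<longleftrightarrow> adjacent G a b" for a b
    by (auto simp: adj_rel_iff VG adj)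
  have inf_diam: "graph_diameter G X = \<infinity>"
    if "f 0 = x" "range f \<subseteq> X" "X \<subseteq> V" "\<And>n. \<exists>i. n \<le> d x (f i)" for f :: "nat \<Rightarrow> 'a" and x X
  proof (rule infinite_diameterI[OF conn, of X x])
    show "\<exists>v\<in>X. n \<le> d x v" for n using that(2) that(4)[of n] by blast
  qed (use that in \<open>auto simp: VG\<close>)
  show ?thesis
  proof (intro conjI ballI impI)
    fix x assume "x \<in> vertices G"
    then have x: "x \<in> V" by (simp add: VG)
    \<comment> \<open>Here the far set is all of \<open>V\<close>.\<close>
    obtain f where f: "f 0 = x" "range f \<subseteq> V" "inj f"
      "\<forall>i j. (f i, f j) \<in> ?E \<longleftrightarrow> \<bar>int i - int j\<bar> = 1" "\<forall>n. \<exists>i. n \<le> d x (f i)"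
      using far_ray_exists[OF x order_refl] infinite_diameter_imp_unbounded[OF conn diam order_refl]
        x VG by metis
    then have "induced_ray G f" by (simp add: induced_ray_def VG E_adj)
    then show "\<exists>f. induced_ray G f \<and> f 0 = x \<and> graph_diameter G (range f) = \<infinity>"
      using inf_diam[of f x "range f"] f by blast
  next
    let ?S = "{v \<in> vertices G. 3 \<le> vertex_degree G v}"
    assume S_diam: "graph_diameter G ?S = \<infinity>"
    \<comment> \<open>Infinite diameter forces \<open>V\<close> to be non-empty, since a supremum
      over the empty set is 0 in \<open>enat\<close>.\<close>
    obtain x where x: "x \<in> V"
      using diam VG by (fastforce simp: graph_diameter_def bot_enat_def)
    have S: "?S \<subseteq> V" by (auto simp: VG)
    have far: "\<exists>s\<in>?S. n \<le> d x s" for n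
      using infinite_diameter_imp_unbounded[OF conn S_diam] S x VG by blast
    have "\<forall>s\<in>?S. \<exists>C. card C = 3 \<and> C \<subseteq> ?E `` {s}"
    proof
      fix s assume "s \<in> ?S"
      then obtain C where "card C = 3" "C \<subseteq> nbhd G s" by (auto simp: vertex_degree_ge_3_iff)
      moreover have "nbhd G s \<subseteq> ?E `` {s}" by (auto simp: nbhd_def E_adj)
      ultimately show "\<exists>C. card C = 3 \<and> C \<subseteq> ?E `` {s}" by blast
    qed
    from toothed_ray_exists[OF x S far this]
    obtain f Y a \<tau> where f: "f 0 = x" "range f \<subseteq> V" "inj f"
      "\<forall>i j. (f i, f j) \<in> ?E \<longleftrightarrow> \<bar>int i - int j\<bar> = 1" "\<forall>n. \<exists>i. n \<le> d x (f i)"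
      and Y: "infinite Y" "Y \<subseteq> V - range f" "\<forall>y\<in>Y. \<forall>y'\<in>Y. (y, y') \<notin> ?E"
      and \<tau>: "0 \<in> \<tau>" "\<tau> \<subseteq> {0, 1, 2}"
      and a: "\<forall>y\<in>Y. \<forall>i. (y, f i) \<in> ?E \<longleftrightarrow> (\<exists>t\<in>\<tau>. i = a y + t)" "\<forall>y\<in>Y. 2 \<le> a y"
        "\<forall>y\<in>Y. \<forall>y'\<in>Y. y \<noteq> y' \<longrightarrow> a y + 4 \<le> a y' \<or> a y' + 4 \<le> a y"
      by (elim exE conjE) (rule that)
    define H where "H = induced_on G (range f \<union> Y)"
    have VH: "vertices H = range f \<union> Y" by (simp add: H_def)
    have adj_H: "adjacent H u v \<longleftrightarrow> (u, v) \<in> ?E" if "u \<in> range f \<union> Y" "v \<in> range f \<union> Y" for u v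
      using that by (simp add: H_def adjacent_induced_on E_adj)
    have "simple_graph G"
      using r by (auto simp: simple_graph_def G inc_graph_def card_insert_if)
    then have "simple_graph H" unfolding H_def by (rule simple_induced_on)
    then have "ray_extension H f Y"
      using f Y adj_H by (auto simp: ray_extension_def induced_ray_def VH)
    then interpret toothed_ray H f Y a \<tau>
      using \<tau> a adj_H by unfold_locales auto
    have HG: "range f \<union> Y \<subseteq> V" using f(2) Y(2) by blast
    have "induced_subgraph_of H G"
      using HG by (simp add: induced_subgraph_of_def VG H_def)
    moreover have "graph_diameter G (vertices H) = \<infinity>"
      using inf_diam[of f x "vertices H"] f HG by (simp add: VH)
    ultimately show "\<exists>H. induced_subgraph_of H G \<and> (comb H \<or> kite H) \<and>
        graph_diameter G (vertices H) = \<infinity> \<and> infinite {v \<in> vertices H. vertex_degree H v \<ge> 3}"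
      using comb_or_kite infinite_branching[OF Y(1)] by blast
  qed
qed

end
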